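(* Let $n$ be an even positive integer, $k\ge 2$, and let $A\in\mathbb{R}^{[k,n]}$ be a cubical tensor. The following statements are equivalent: (i) $A$ is a Hamiltonian cubical tensor; (ii) $A=JR$ for some supersymmetric tensor $R\in\mathbb{R}^{[k,n]}$; (iii) $JA$ is supersymmetric.
   Context: $\mathbb{R}^{[k,n]}$ denotes the set of real cubical tensors of order $k$ and dimension $n$, i.e. arrays $(A_{i_1\ldots i_k})$ with $1\le i_1,\dots,i_k\le n$. For a matrix $R\in\mathbb{R}^{n\times n}$ and $A\in\mathbb{R}^{[k,n]}$, the product $RA\in\mathbb{R}^{[k,n]}$ is $(RA)_{i_1i_2\ldots i_k}=\sum_{j=1}^nR_{i_1j}A_{ji_2\ldots i_k}$. A tensor is supersymmetric if its entries are invariant under every permutation of the indices. For a permutation $\sigma$ of $\{1,\dots,k\}$, the transpose $A^{\top_\sigma}$ is the tensor $Y$ with $Y_{i_{\sigma(1)}\ldots i_{\sigma(k)}}=A_{i_1\ldots i_k}$. For even $n=2m$, $J=\begin{pmatrix}0&I_m\\-I_m&0\end{pmatrix}\in\mathbb{R}^{n\times n}$. A tensor $A\in\mathbb{R}^{[k,n]}$ is a Hamiltonian cubical tensor if $(J^\top A)^{\top_\sigma}+JA=0$ for every permutation $\sigma$ of $\{1,\dots,k\}$. *)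

theory Defs
  imports "HOL-Library.FuncSet" "HOL-Combinatorics.Permutations" "Jordan_Normal_Form.Matrix"
begin

text \<open>
  Everything is 0-based, in line with \<^typ>\<open>real mat\<close>: a multi-index of order \<open>k\<close> and
  dimension \<open>n\<close> is an extensional function from positions \<open>{..<k}\<close> to values \<open>{..<n}\<close>, and
  a tensor is an extensional function on multi-indices. Hence equality of tensors is plain
  equality, and permuting the indices is composition with a permutation of \<open>{..<k}\<close>.
\<close>

type_synonym tensor = "(nat \<Rightarrow> nat) \<Rightarrow> real"

definition multi_indices :: "nat \<Rightarrow> nat \<Rightarrow> (nat \<Rightarrow> nat) set" where
  "multi_indices k n = {..<k} \<rightarrow>\<^sub>E {..<n}"

definition tensors :: "nat \<Rightarrow> nat \<Rightarrow> tensor set" where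
  "tensors k n = multi_indices k n \<rightarrow>\<^sub>E UNIV"

definition zero_tensor :: "nat \<Rightarrow> nat \<Rightarrow> tensor" where
  "zero_tensor k n = (\<lambda>i\<in>multi_indices k n. 0)"

definition add_tensor :: "nat \<Rightarrow> nat \<Rightarrow> tensor \<Rightarrow> tensor \<Rightarrow> tensor" where
  "add_tensor k n A B = (\<lambda>i\<in>multi_indices k n. A i + B i)"

text \<open>Meaningful for \<open>k > 0\<close> only, since the product acts on the first index, position \<open>0\<close>.\<close>

definition mat_tensor_mult :: "nat \<Rightarrow> nat \<Rightarrow> real mat \<Rightarrow> tensor \<Rightarrow> tensor" where
  "mat_tensor_mult k n R A =
     (\<lambda>i\<in>multi_indices k n. \<Sum>j<n. R $$ (i 0, j) * A (i(0 := j)))"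

definition transpose_tensor :: "nat \<Rightarrow> nat \<Rightarrow> (nat \<Rightarrow> nat) \<Rightarrow> tensor \<Rightarrow> tensor" where
  "transpose_tensor k n \<sigma> A = (\<lambda>i\<in>multi_indices k n. A (i \<circ> Hilbert_Choice.inv \<sigma>))"

lemma multi_indices_permute:
  assumes "\<sigma> permutes {..<k}" "i \<in> multi_indices k n"
  shows "i \<circ> \<sigma> \<in> multi_indices k n"
proof -
  have "(i \<circ> \<sigma>) p \<in> {..<n}" if "p \<in> {..<k}" for p
    using that permutes_in_image[OF assms(1), of p]
      PiE_mem[OF assms(2)[unfolded multi_indices_def], of "\<sigma> p"] by simp
  moreover have "(i \<circ> \<sigma>) p = undefined" if "p \<notin> {..<k}" for p
    using that permutes_not_in[OF assms(1) that]
      PiE_arb[OF assms(2)[unfolded multi_indices_def] that] by simp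
  ultimately show ?thesis
    unfolding multi_indices_def by (intro PiE_I)
qed

text \<open>
  The inverse in \<^const>\<open>transpose_tensor\<close> comes from solving the usual defining equation
  \<open>Y (i \<circ> \<sigma>) = A i\<close> for \<open>Y\<close>, which then has exactly one solution:
\<close>

lemma transpose_tensor_unique:
  assumes "\<sigma> permutes {..<k}"
  shows "Y = transpose_tensor k n \<sigma> A \<longleftrightarrow>
         Y \<in> tensors k n \<and> (\<forall>i\<in>multi_indices k n. Y (i \<circ> \<sigma>) = A i)"
proof
  assume "Y = transpose_tensor k n \<sigma> A"
  moreover have "(i \<circ> \<sigma>) \<circ> Hilbert_Choice.inv \<sigma> = i" for i :: "nat \<Rightarrow> nat"
    by (simp only: comp_assoc permutes_inv_o(1)[OF assms] comp_id)
  ultimately show "Y \<in> tensors k n \<and> (\<forall>i\<in>multi_indices k n. Y (i \<circ> \<sigma>) = A i)"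
    by (simp add: transpose_tensor_def tensors_def multi_indices_permute[OF assms])
next
  assume Y: "Y \<in> tensors k n \<and> (\<forall>i\<in>multi_indices k n. Y (i \<circ> \<sigma>) = A i)"
  show "Y = transpose_tensor k n \<sigma> A"
  proof
    fix i
    show "Y i = transpose_tensor k n \<sigma> A i"
    proof (cases "i \<in> multi_indices k n")
      case True
      have "i \<circ> Hilbert_Choice.inv \<sigma> \<in> multi_indices k n"
        using multi_indices_permute[OF permutes_inv[OF assms] True] .
      then have "Y ((i \<circ> Hilbert_Choice.inv \<sigma>) \<circ> \<sigma>) = A (i \<circ> Hilbert_Choice.inv \<sigma>)"
        using Y by blast
      moreover have "(i \<circ> Hilbert_Choice.inv \<sigma>) \<circ> \<sigma> = i"
        by (simp only: comp_assoc permutes_inv_o(2)[OF assms] comp_id)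
      ultimately show ?thesis
        using True by (simp add: transpose_tensor_def)
    next
      case False
      then show ?thesis
        using PiE_arb[OF Y[THEN conjunct1, unfolded tensors_def] False]
        by (simp add: transpose_tensor_def)
    qed
  qed
qed

definition supersymmetric :: "nat \<Rightarrow> nat \<Rightarrow> tensor \<Rightarrow> bool" where
  "supersymmetric k n A \<longleftrightarrow>
     (\<forall>\<sigma>. \<sigma> permutes {..<k} \<longrightarrow> (\<forall>i\<in>multi_indices k n. A (i \<circ> \<sigma>) = A i))"

text \<open>An \<open>n \<times> n\<close> matrix only for even \<open>n\<close>.\<close>

definition J_mat :: "nat \<Rightarrow> real mat" where
  "J_mat n = (let m = n div 2 in
     four_block_mat (0\<^sub>m m m) (1\<^sub>m m) (- 1\<^sub>m m) (0\<^sub>m m m))"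

definition hamiltonian_tensor :: "nat \<Rightarrow> nat \<Rightarrow> tensor \<Rightarrow> bool" where
  "hamiltonian_tensor k n A \<longleftrightarrow>
     A \<in> tensors k n \<and>
     (\<forall>\<sigma>. \<sigma> permutes {..<k} \<longrightarrow>
        add_tensor k n
          (transpose_tensor k n \<sigma> (mat_tensor_mult k n (transpose_mat (J_mat n)) A))
          (mat_tensor_mult k n (J_mat n) A)
        = zero_tensor k n)"

end

theory Submission
  imports Defs
begin

text \<open>
  Since \<open>J\<^sup>\<top> = -J\<close>, the Hamiltonian condition says that \<open>J A\<close> equals each of its transposes.
  Since \<open>J J = -I\<close>, the equations \<open>A = J R\<close> and \<open>R = -J A\<close> are equivalent.
\<close>

lemma multi_indices_upd:
  assumes "i \<in> multi_indices k n" "p < k" "j < n"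
  shows "i(p := j) \<in> multi_indices k n"
  using assms by (auto simp: multi_indices_def PiE_iff extensional_def)

lemma multi_indices_less:
  assumes "i \<in> multi_indices k n" "p < k"
  shows "i p < n"
  using assms by (auto simp: multi_indices_def)

lemma tensors_eqI:
  assumes "A \<in> tensors k n" "B \<in> tensors k n" "\<And>i. i \<in> multi_indices k n \<Longrightarrow> A i = B i"
  shows "A = B"
  using assms unfolding tensors_def by (rule PiE_ext)

lemma mat_tensor_mult_in_tensors: "mat_tensor_mult k n R A \<in> tensors k n"
  by (simp add: mat_tensor_mult_def tensors_def)

lemma mat_tensor_mult_one:
  assumes "0 < k" "A \<in> tensors k n"
  shows "mat_tensor_mult k n (1\<^sub>m n) A = A"
proof (rule tensors_eqI[OF mat_tensor_mult_in_tensors assms(2)])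
  fix i assume i: "i \<in> multi_indices k n"
  \<comment> \<open>Row \<open>i 0\<close> of the identity keeps only the term
    \<open>j = i 0\<close>, where \<open>i(0 := i 0)\<close> is \<open>i\<close>.\<close>
  have "(\<Sum>j<n. 1\<^sub>m n $$ (i 0, j) * A (i(0 := j))) = (\<Sum>j<n. if j = i 0 then A i else 0)"
    using multi_indices_less[OF i assms(1)] by (intro sum.cong) auto
  then show "mat_tensor_mult k n (1\<^sub>m n) A i = A i"
    using i multi_indices_less[OF i assms(1)] by (simp add: mat_tensor_mult_def)
qed

text \<open>Both products act on position \<open>0\<close>, so the inner update overwrites the outer
  one and exchanging the two finite sums gives the entries of \<open>R * S\<close>. This reduces
  \<open>J (J A)\<close> to the matrix square of \<open>J\<close>.\<close>

lemma mat_tensor_mult_mult: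
  assumes "0 < k" "R \<in> carrier_mat n n" "S \<in> carrier_mat n n"
  shows "mat_tensor_mult k n R (mat_tensor_mult k n S A) = mat_tensor_mult k n (R * S) A"
proof (rule tensors_eqI[OF mat_tensor_mult_in_tensors mat_tensor_mult_in_tensors])
  fix i assume i: "i \<in> multi_indices k n"
  have "mat_tensor_mult k n R (mat_tensor_mult k n S A) i
      = (\<Sum>j<n. \<Sum>l<n. R $$ (i 0, j) * S $$ (j, l) * A (i(0 := l)))"
    using i multi_indices_upd[OF i assms(1)]
    by (simp add: mat_tensor_mult_def sum_distrib_left mult.assoc)
  also have "\<dots> = (\<Sum>l<n. (\<Sum>j<n. R $$ (i 0, j) * S $$ (j, l)) * A (i(0 := l)))"
    by (subst sum.swap) (simp add: sum_distrib_right)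
  also have "\<dots> = mat_tensor_mult k n (R * S) A i"
    using i multi_indices_less[OF i assms(1)] assms(2,3)
    by (simp add: mat_tensor_mult_def scalar_prod_def atLeast0LessThan)
  finally show "mat_tensor_mult k n R (mat_tensor_mult k n S A) i
      = mat_tensor_mult k n (R * S) A i" .
qed

text \<open>Stated entrywise: outside the multi-indices a tensor is \<open>undefined\<close>, so
  pointwise negation of a tensor need not be a tensor.\<close>

lemma mat_tensor_mult_uminus:
  assumes "0 < k" "R \<in> carrier_mat n n" "i \<in> multi_indices k n"
  shows "mat_tensor_mult k n (- R) A i = - mat_tensor_mult k n R A i"
  using assms multi_indices_less[OF assms(3,1)]
  by (simp add: mat_tensor_mult_def sum_negf)

text \<open>Agreement up to sign on the multi-indices suffices because permuting positions maps this
  set to itself.\<close>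

lemma supersymmetric_uminus:
  assumes "\<And>i. i \<in> multi_indices k n \<Longrightarrow> B i = - A i"
  shows "supersymmetric k n B \<longleftrightarrow> supersymmetric k n A"
  using assms by (simp add: supersymmetric_def multi_indices_permute)

text \<open>The transpose composes with the inverse of \<sigma>, supersymmetry with \<sigma> itself.
  Inversion is a bijection on permutations, so quantifying over all of them removes the
  difference.\<close>

lemma supersymmetric_iff_transpose_tensor:
  "supersymmetric k n A \<longleftrightarrow>
     (\<forall>\<sigma>. \<sigma> permutes {..<k} \<longrightarrow> (\<forall>i\<in>multi_indices k n. transpose_tensor k n \<sigma> A i = A i))"
proof
  assume "supersymmetric k n A"
  then show "\<forall>\<sigma>. \<sigma> permutes {..<k} \<longrightarrow>
      (\<forall>i\<in>multi_indices k n. transpose_tensor k n \<sigma> A i = A i)"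
    by (simp add: supersymmetric_def transpose_tensor_def permutes_inv)
next
  assume *: "\<forall>\<sigma>. \<sigma> permutes {..<k} \<longrightarrow>
      (\<forall>i\<in>multi_indices k n. transpose_tensor k n \<sigma> A i = A i)"
  show "supersymmetric k n A"
    unfolding supersymmetric_def
  proof (intro allI impI ballI)
    fix \<sigma> i assume \<sigma>: "\<sigma> permutes {..<k}" and i: "i \<in> multi_indices k n"
    show "A (i \<circ> \<sigma>) = A i"
      using *[rule_format, OF permutes_inv[OF \<sigma>] i] i
      by (simp add: transpose_tensor_def permutes_inv_inv[OF \<sigma>])
  qed
qed

lemma J_mat_carrier:
  assumes "even n"
  shows "J_mat n \<in> carrier_mat n n"
  using assms by (intro carrier_matI) (auto simp: J_mat_def Let_def)

lemma transpose_J_mat: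
  assumes "even n"
  shows "transpose_mat (J_mat n) = - J_mat n"
  using assms by (intro eq_matI) (auto simp: J_mat_def Let_def)

lemma J_mat_square:
  assumes "even n"
  shows "J_mat n * J_mat n = - 1\<^sub>m n"
proof -
  define m where "m = n div 2"
  have n: "n = m + m" using assms by (auto simp: m_def)
  have c: "- 1\<^sub>m m \<in> carrier_mat m m" for m :: nat by simp
  \<comment> \<open>The lower left block comes from \<open>-1\<close> times \<open>0\<close> and is
    kept as a negated zero matrix; the entrywise comparison below disposes of it.\<close>
  have "J_mat n * J_mat n = four_block_mat (- 1\<^sub>m m) (0\<^sub>m m m) (- 0\<^sub>m m m) (- 1\<^sub>m m)"
    unfolding J_mat_def Let_def m_def[symmetric]
    by (subst mult_four_block_mat[OF zero_carrier_mat one_carrier_mat c zero_carrier_mat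
          zero_carrier_mat one_carrier_mat c zero_carrier_mat]) (simp cong: cong_four_block_mat)
  also have "\<dots> = - 1\<^sub>m n"
    by (intro eq_matI) (auto simp: n)
  finally show ?thesis .
qed

lemma hamiltonian_tensor_iff:
  assumes "even n" "0 < k" "A \<in> tensors k n"
  shows "hamiltonian_tensor k n A \<longleftrightarrow> supersymmetric k n (mat_tensor_mult k n (J_mat n) A)"
proof -
  let ?B = "mat_tensor_mult k n (J_mat n) A"
  let ?C = "mat_tensor_mult k n (transpose_mat (J_mat n)) A"
  have C: "?C i = - ?B i" if "i \<in> multi_indices k n" for i
    using that assms by (simp add: transpose_J_mat mat_tensor_mult_uminus J_mat_carrier)
  have "add_tensor k n (transpose_tensor k n \<sigma> ?C) ?B = zero_tensor k n \<longleftrightarrow>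
      (\<forall>i\<in>multi_indices k n. transpose_tensor k n \<sigma> ?B i = ?B i)"
    if \<sigma>: "\<sigma> permutes {..<k}" for \<sigma>
  proof -
    have "add_tensor k n (transpose_tensor k n \<sigma> ?C) ?B = zero_tensor k n \<longleftrightarrow>
        (\<forall>i\<in>multi_indices k n. transpose_tensor k n \<sigma> ?C i + ?B i = 0)"
      \<comment> \<open>Both tensors are \<open>undefined\<close> off the multi-indices, so only
        entries on them matter.\<close>
      by (auto simp: add_tensor_def zero_tensor_def fun_eq_iff restrict_def)
    also have "\<dots> \<longleftrightarrow> (\<forall>i\<in>multi_indices k n. transpose_tensor k n \<sigma> ?B i = ?B i)"
      \<comment> \<open>The sign passes through the transpose: the permuted index is again a
        multi-index, so \<open>C\<close> applies there.\<close>
      using C multi_indices_permute[OF permutes_inv[OF \<sigma>]]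
      by (intro ball_cong refl) (auto simp: transpose_tensor_def)
    finally show ?thesis .
  qed
  then show ?thesis
    using assms(3) by (simp add: hamiltonian_tensor_def supersymmetric_iff_transpose_tensor)
qed

lemma J_mat_tensor_mult_twice:
  assumes "even n" "0 < k" "A \<in> tensors k n" "i \<in> multi_indices k n"
  shows "mat_tensor_mult k n (J_mat n) (mat_tensor_mult k n (J_mat n) A) i = - A i"
  using assms
  by (simp add: mat_tensor_mult_mult J_mat_carrier J_mat_square mat_tensor_mult_uminus
      mat_tensor_mult_one)

lemma J_mat_tensor_mult_supersymmetric_iff:
  assumes "even n" "0 < k" "A \<in> tensors k n"
  shows "(\<exists>R\<in>tensors k n. supersymmetric k n R \<and> A = mat_tensor_mult k n (J_mat n) R) \<longleftrightarrow>
         supersymmetric k n (mat_tensor_mult k n (J_mat n) A)"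
proof
  assume "\<exists>R\<in>tensors k n. supersymmetric k n R \<and> A = mat_tensor_mult k n (J_mat n) R"
  then obtain R where R: "R \<in> tensors k n" "supersymmetric k n R"
      "A = mat_tensor_mult k n (J_mat n) R"
    by blast
  \<comment> \<open>Here \<open>J A = J (J R) = -R\<close>, which is as symmetric as
    \<open>R\<close>.\<close>
  have "mat_tensor_mult k n (J_mat n) A i = - R i" if "i \<in> multi_indices k n" for i
    using J_mat_tensor_mult_twice[OF assms(1,2) R(1) that] R(3) by simp
  then show "supersymmetric k n (mat_tensor_mult k n (J_mat n) A)"
    using supersymmetric_uminus R(2) by blast
next
  assume B: "supersymmetric k n (mat_tensor_mult k n (J_mat n) A)"
  have J: "J_mat n \<in> carrier_mat n n" using J_mat_carrier[OF assms(1)] .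
  \<comment> \<open>The inverse of \<open>J\<close> is \<open>-J\<close>, so this is the only
    possible solution of \<open>A = J R\<close>. Putting the sign on the matrix makes it a tensor by
    construction.\<close>
  let ?R = "mat_tensor_mult k n (- J_mat n) A"
  have "supersymmetric k n ?R"
    using supersymmetric_uminus[of k n ?R, OF mat_tensor_mult_uminus[OF assms(2) J]] B by simp
  moreover have "J_mat n * - J_mat n = 1\<^sub>m n"
    using uminus_mult_right_mat[of "J_mat n" "J_mat n"] J J_mat_square[OF assms(1)] by simp
  then have "A = mat_tensor_mult k n (J_mat n) ?R"
    using J assms(2,3) by (simp add: mat_tensor_mult_mult mat_tensor_mult_one)
  ultimately show "\<exists>R\<in>tensors k n. supersymmetric k n R \<and> A = mat_tensor_mult k n (J_mat n) R"
    using mat_tensor_mult_in_tensors by blast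
qed

theorem proposition2:
  fixes k n :: nat and A :: tensor
  assumes "even n" and "n > 0" and "k \<ge> 2" and "A \<in> tensors k n"
  shows "(hamiltonian_tensor k n A \<longleftrightarrow>
            (\<exists>R\<in>tensors k n. supersymmetric k n R \<and> A = mat_tensor_mult k n (J_mat n) R))
       \<and> ((\<exists>R\<in>tensors k n. supersymmetric k n R \<and> A = mat_tensor_mult k n (J_mat n) R) \<longleftrightarrow>
            supersymmetric k n (mat_tensor_mult k n (J_mat n) A))"
proof -
  have "0 < k" using assms(3) by simp
  then show ?thesis
    \<comment> \<open>Supersymmetry of \<open>J A\<close> is the common middle term: each of the
      other two statements is equivalent to it.\<close>
    using hamiltonian_tensor_iff[OF assms(1) _ assms(4)]
      J_mat_tensor_mult_supersymmetric_iff[OF assms(1) _ assms(4)] by blast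
qed

end
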